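(* Let $r,s,t,p$ be positive integers with $(r,s)\neq(t,p)$. Then the quiver with 4 nodes represented by the skew-symmetric matrix $$B=\begin{bmatrix}0&r&s&t\\-r&0&t&p\\-s&-t&0&r\\-t&-p&-r&0\end{bmatrix}$$ is 2-periodic.
   Context: A quiver with $N$ nodes (an oriented graph without loops or 2-cycles) is represented by an $N\times N$ skew-symmetric integer matrix $B=[b_{ij}]$, a positive entry $b_{ij}$ being the number of arrows from node $i$ to node $j$. The mutation $\mu_k$ at node $k$ sends $B$ to $\mu_k(B)=[b'_{ij}]$, where $b'_{ij}=-b_{ij}$ if $(k-i)(k-j)=0$, and $b'_{ij}=b_{ij}+\frac12\left(|b_{ik}|b_{kj}+b_{ik}|b_{kj}|\right)$ otherwise. Let $\sigma$ be the $N\times N$ permutation matrix with entries $\sigma_{i,i+1}=1$ for $1\le i\le N-1$, $\sigma_{N,1}=1$, and all other entries $0$. The quiver represented by $B$ is $m$-periodic if $m$ is the smallest positive integer such that $\mu_m\circ\cdots\circ\mu_1(B)=\sigma^{-m}B\,\sigma^m$. *)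

theory Defs
  imports "Jordan_Normal_Form.Matrix"
begin

text \<open>
  The nodes \<open>1, \<dots>, N\<close> of a quiver are the matrix indices \<open>0, \<dots>, N - 1\<close>.
  For an integer matrix, skew-symmetry already forces a zero diagonal (no loops).
\<close>

definition quiver_matrix :: "nat \<Rightarrow> int mat \<Rightarrow> bool" where
  "quiver_matrix N B \<longleftrightarrow> B \<in> carrier_mat N N \<and> transpose_mat B = - B"

text \<open>The halving in the mutation rule is exact:\<close>

lemma even_mutation_term: "even (\<bar>x\<bar> * y + x * \<bar>y\<bar>)" for x y :: int
  by (simp add: abs_if)

definition mutate :: "nat \<Rightarrow> int mat \<Rightarrow> int mat" where
  "mutate k B = mat (dim_row B) (dim_col B) (\<lambda>(i, j).
     if i = k \<or> j = k then - B $$ (i, j)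
     else B $$ (i, j) + (\<bar>B $$ (i, k)\<bar> * B $$ (k, j) + B $$ (i, k) * \<bar>B $$ (k, j)\<bar>) div 2)"

text \<open>
  The composite \<open>\<mu>\<^sub>m \<circ> \<dots> \<circ> \<mu>\<^sub>1\<close>, with \<open>\<mu>\<^sub>1\<close> applied first.  For \<open>m > N\<close> the node labels
  are read cyclically modulo \<open>N\<close>.
\<close>

definition mutations :: "nat \<Rightarrow> nat \<Rightarrow> int mat \<Rightarrow> int mat" where
  "mutations N m B = fold (\<lambda>k. mutate (k mod N)) [0..<m] B"

definition cyclic_perm_mat :: "nat \<Rightarrow> int mat" where
  "cyclic_perm_mat N = mat N N (\<lambda>(i, j). if j = Suc i \<or> (i = N - 1 \<and> j = 0) then 1 else 0)"

definition mutation_rotates :: "nat \<Rightarrow> nat \<Rightarrow> int mat \<Rightarrow> bool" where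
  "mutation_rotates N m B \<longleftrightarrow>
     mutations N m B =
       inv\<^bsub>ring_mat TYPE(int) N ()\<^esub> (cyclic_perm_mat N ^\<^sub>m m) * B * (cyclic_perm_mat N ^\<^sub>m m)"

definition periodic_quiver :: "nat \<Rightarrow> nat \<Rightarrow> int mat \<Rightarrow> bool" where
  "periodic_quiver N m B \<longleftrightarrow>
     quiver_matrix N B \<and> m > 0 \<and> mutation_rotates N m B \<and>
     (\<forall>m'. 0 < m' \<and> m' < m \<longrightarrow> \<not> mutation_rotates N m' B)"

end

theory Submission imports Defs "HOL-Number_Theory.Cong"
begin

text \<open>
  Conjugation by \<open>\<sigma>\<^sup>m\<close> shifts both indices by \<open>m\<close> modulo \<open>N\<close>.  Node 1 of the given quiver is a
  source, and node 2 is a source after the first mutation, so both mutations only reverse arrows;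
  comparing entries gives the rotation for \<open>m = 2\<close>, whereas for \<open>m = 1\<close> it would force
  \<open>r = t\<close> and \<open>s = p\<close>.
\<close>

lemma mat_eq_iff_index:
  assumes "A \<in> carrier_mat m n" "B \<in> carrier_mat m n"
  shows "A = B \<longleftrightarrow> (\<forall>i<m. \<forall>j<n. A $$ (i, j) = B $$ (i, j))"
  using assms by (metis carrier_matD eq_matI)

lemma pow_mat_add:
  assumes "A \<in> carrier_mat n n"
  shows "A ^\<^sub>m (a + b) = A ^\<^sub>m a * A ^\<^sub>m b"
proof (induction b)
  case 0
  then show ?case using assms by simp
next
  case (Suc b)
  then show ?case
    using assms by (simp add: assoc_mult_mat[of _ n n _ n _ n] pow_carrier_mat)
qed

lemma cyclic_perm_mat_carrier [simp]: "cyclic_perm_mat N \<in> carrier_mat N N"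
  by (simp add: cyclic_perm_mat_def)

text \<open>Absorbs the wrap-around entry of the last row into a reduction modulo \<open>N\<close>,
  the form that iterates under powers.\<close>

lemma cyclic_perm_mat_index:
  assumes "i < N" "j < N"
  shows "cyclic_perm_mat N $$ (i, j) = (if j = Suc i mod N then 1 else 0)"
proof (cases "Suc i = N")
  case True
  with assms show ?thesis by (auto simp: cyclic_perm_mat_def)
next
  case False
  with assms have "Suc i < N" by simp
  with assms show ?thesis by (auto simp: cyclic_perm_mat_def)
qed

text \<open>Each further right factor \<open>cyclic_perm_mat N\<close> moves the single 1 of row
  \<open>i\<close> one column on, cyclically, so the exponent turns into an index shift.\<close>

lemma cyclic_perm_mat_pow_index:
  assumes "i < N" "j < N"
  shows "(cyclic_perm_mat N ^\<^sub>m m) $$ (i, j) = (if j = (i + m) mod N then 1 else 0)"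
  using assms
proof (induction m arbitrary: j)
  case 0
  then show ?case by (auto simp: cyclic_perm_mat_def)
next
  case (Suc m)
  have "(cyclic_perm_mat N ^\<^sub>m Suc m) $$ (i, j) =
      (\<Sum>k<N. (cyclic_perm_mat N ^\<^sub>m m) $$ (i, k) * cyclic_perm_mat N $$ (k, j))"
    using Suc.prems carrier_matD[OF pow_carrier_mat[OF cyclic_perm_mat_carrier[of N], of m]]
      carrier_matD[OF cyclic_perm_mat_carrier[of N]]
    by (simp add: scalar_prod_def atLeast0LessThan)
  also have "\<dots> = (\<Sum>k<N. if k = (i + m) mod N then cyclic_perm_mat N $$ (k, j) else 0)"
    using Suc by (intro sum.cong) auto
  also have "\<dots> = cyclic_perm_mat N $$ ((i + m) mod N, j)"
    using Suc.prems by simp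
  also have "\<dots> = (if j = (i + Suc m) mod N then 1 else 0)"
    using Suc.prems by (simp add: cyclic_perm_mat_index mod_Suc_eq)
  finally show ?case .
qed

lemma cyclic_perm_mat_pow_self_mult: "cyclic_perm_mat N ^\<^sub>m (N * m) = 1\<^sub>m N"
  using carrier_matD[OF pow_carrier_mat[OF cyclic_perm_mat_carrier[of N], of "N * m"]]
  by (intro eq_matI) (auto simp: cyclic_perm_mat_pow_index simp del: pow_mat_dim)

text \<open>The exponent \<open>N * m\<close> gives the identity, so the inverse of the
  \<open>m\<close>-th power is again a power with a natural exponent, the complement of
  \<open>m\<close> in \<open>N * m\<close>.\<close>

lemma inv_cyclic_perm_mat_pow:
  assumes "N > 0"
  shows "inv\<^bsub>ring_mat TYPE(int) N ()\<^esub> (cyclic_perm_mat N ^\<^sub>m m) = cyclic_perm_mat N ^\<^sub>m ((N - 1) * m)"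
    and "cyclic_perm_mat N ^\<^sub>m ((N - 1) * m) * cyclic_perm_mat N ^\<^sub>m m = 1\<^sub>m N"
    and "cyclic_perm_mat N ^\<^sub>m m * cyclic_perm_mat N ^\<^sub>m ((N - 1) * m) = 1\<^sub>m N"
proof -
  interpret ring "ring_mat TYPE(int) N ()" by (rule ring_mat)
  have *: "(N - 1) * m + m = N * m"
    using assms by (cases N) auto
  show 1: "cyclic_perm_mat N ^\<^sub>m ((N - 1) * m) * cyclic_perm_mat N ^\<^sub>m m = 1\<^sub>m N"
    and 2: "cyclic_perm_mat N ^\<^sub>m m * cyclic_perm_mat N ^\<^sub>m ((N - 1) * m) = 1\<^sub>m N"
    using * by (simp_all add: cyclic_perm_mat_pow_self_mult add.commute
        flip: pow_mat_add[OF cyclic_perm_mat_carrier])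
  show "inv\<^bsub>ring_mat TYPE(int) N ()\<^esub> (cyclic_perm_mat N ^\<^sub>m m) = cyclic_perm_mat N ^\<^sub>m ((N - 1) * m)"
    by (intro inv_char) (use 1 2 in \<open>simp_all add: ring_mat_simps pow_carrier_mat\<close>)
qed

lemma mutate_carrier:
  assumes "B \<in> carrier_mat m n"
  shows "mutate k B \<in> carrier_mat m n"
  using assms by (auto simp: mutate_def)

lemma mutations_carrier:
  assumes "B \<in> carrier_mat N N"
  shows "mutations N m B \<in> carrier_mat N N"
  using assms by (induction m) (auto simp: mutations_def mutate_carrier)

text \<open>Turns periodicity into a finite comparison of entries: once the inverse is cleared,
  \<open>P\<close> on the left shifts row indices and \<open>P\<close> on the right shifts column
  indices.\<close>

lemma mutation_rotates_iff:
  assumes N: "N > 0" and B: "B \<in> carrier_mat N N"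
  shows "mutation_rotates N m B \<longleftrightarrow>
    (\<forall>i<N. \<forall>j<N. mutations N m B $$ ((i + m) mod N, (j + m) mod N) = B $$ (i, j))"
proof -
  define P where "P = cyclic_perm_mat N ^\<^sub>m m"
  define Q where "Q = cyclic_perm_mat N ^\<^sub>m ((N - 1) * m)"
  define X where "X = mutations N m B"
  have P: "P \<in> carrier_mat N N" and Q: "Q \<in> carrier_mat N N" and X: "X \<in> carrier_mat N N"
    using B by (simp_all add: P_def Q_def X_def pow_carrier_mat mutations_carrier)
  have QP: "Q * P = 1\<^sub>m N" and PQ: "P * Q = 1\<^sub>m N"
    and inv: "inv\<^bsub>ring_mat TYPE(int) N ()\<^esub> P = Q"
    using inv_cyclic_perm_mat_pow[OF N, of m] by (simp_all add: P_def Q_def)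
  have Pij: "P $$ (i, j) = (if j = (i + m) mod N then 1 else 0)" if "i < N" "j < N" for i j
    using that by (simp add: P_def cyclic_perm_mat_pow_index)
  \<comment> \<open>Hence the only 1 of \<open>P\<close> in column \<open>(j + m) mod N\<close> sits
    in row \<open>j\<close>, which collapses the sum for \<open>B * P\<close>.\<close>
  have shift_inj: "(i + m) mod N = (j + m) mod N \<longleftrightarrow> i = j" if "i < N" "j < N" for i j
    using that cong_add_rcancel_nat[of i m j N] by (simp add: cong_def)
  have PX: "(P * X) $$ (i, j) = X $$ ((i + m) mod N, j)" if "i < N" "j < N" for i j
  proof -
    have "(P * X) $$ (i, j) = (\<Sum>k<N. P $$ (i, k) * X $$ (k, j))"
      using P X that by (simp add: scalar_prod_def atLeast0LessThan)
    also have "\<dots> = (\<Sum>k<N. if k = (i + m) mod N then X $$ (k, j) else 0)"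
      using that by (intro sum.cong) (auto simp: Pij)
    finally show ?thesis using N by simp
  qed
  \<comment> \<open>Right multiplication by \<open>P\<close> moves column \<open>j\<close> to
    position \<open>(j + m) mod N\<close>; evaluating there avoids subtraction modulo
    \<open>N\<close>.\<close>
  have BP: "(B * P) $$ (i, (j + m) mod N) = B $$ (i, j)" if "i < N" "j < N" for i j
  proof -
    have "(B * P) $$ (i, (j + m) mod N) = (\<Sum>k<N. B $$ (i, k) * P $$ (k, (j + m) mod N))"
      using B P that by (simp add: scalar_prod_def atLeast0LessThan)
    also have "\<dots> = (\<Sum>k<N. if k = j then B $$ (i, k) else 0)"
      using that by (intro sum.cong) (auto simp: Pij shift_inj)
    finally show ?thesis using that by simp
  qed
  have "mutation_rotates N m B \<longleftrightarrow> X = Q * B * P"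
    by (simp add: mutation_rotates_def inv flip: P_def X_def)
  also have "\<dots> \<longleftrightarrow> P * X = B * P"
  proof
    assume "X = Q * B * P"
    then have "P * X = (P * Q) * B * P"
      using P Q B by (simp add: assoc_mult_mat[of _ N N _ N _ N])
    then show "P * X = B * P" using PQ B by simp
  next
    assume "P * X = B * P"
    then have "Q * B * P = (Q * P) * X"
      using P Q B X by (simp add: assoc_mult_mat[of _ N N _ N _ N])
    then show "X = Q * B * P" using QP X by simp
  qed
  also have "\<dots> \<longleftrightarrow> (\<forall>i<N. \<forall>j<N. (P * X) $$ (i, j) = (B * P) $$ (i, j))"
    using P X B by (intro mat_eq_iff_index) auto
  also have "\<dots> \<longleftrightarrow> (\<forall>i<N. \<forall>j<N. (P * X) $$ (i, (j + m) mod N) = (B * P) $$ (i, (j + m) mod N))"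
  proof -
    \<comment> \<open>The shift is onto, so testing only shifted columns loses nothing. Adding
      \<open>(N - 1) * m\<close> in the witness amounts to subtracting \<open>m\<close> modulo
      \<open>N\<close>.\<close>
    have "\<exists>k<N. j = (k + m) mod N" if "j < N" for j
    proof (intro exI conjI)
      show "(j + (N - 1) * m) mod N < N" using N by simp
      have "j + (N - 1) * m + m = j + N * m" using N by (cases N) auto
      then show "j = ((j + (N - 1) * m) mod N + m) mod N"
        using that by (simp only: mod_add_left_eq mod_mult_self2 mod_less)
    qed
    then show ?thesis using N by (metis mod_less_divisor)
  qed
  also have "\<dots> \<longleftrightarrow> (\<forall>i<N. \<forall>j<N. X $$ ((i + m) mod N, (j + m) mod N) = B $$ (i, j))"
    using N by (auto simp: PX BP)
  finally show ?thesis by (simp add: X_def)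
qed

theorem mainTheorem2:
  fixes r s t p :: int
  assumes "r > 0" and "s > 0" and "t > 0" and "p > 0"
    and "(r, s) \<noteq> (t, p)"
  shows "periodic_quiver 4 2
    (mat_of_rows_list 4
      [[  0,  r,  s, t],
       [- r,  0,  t, p],
       [- s, - t,  0, r],
       [- t, - p, - r, 0]])"
proof -
  define M :: "int list list \<Rightarrow> int mat" where "M = mat_of_rows_list 4"
  define B where "B = M [[0, r, s, t], [- r, 0, t, p], [- s, - t, 0, r], [- t, - p, - r, 0]]"
  define B1 where "B1 = M [[0, - r, - s, - t], [r, 0, t, p], [s, - t, 0, r], [t, - p, - r, 0]]"
  define B2 where "B2 = M [[0, r, - s, - t], [- r, 0, - t, - p], [s, t, 0, r], [t, p, - r, 0]]"
  have all4: "(\<forall>i<4. Q i) \<longleftrightarrow> Q 0 \<and> Q 1 \<and> Q 2 \<and> Q 3" for Q :: "nat \<Rightarrow> bool"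
    by (auto simp: less_Suc_eq numeral_eq_Suc)
  have M: "M xs \<in> carrier_mat 4 4" if "length xs = 4" for xs
    using that by (intro carrier_matI) (simp_all add: M_def mat_of_rows_list_def)
  have B: "B \<in> carrier_mat 4 4" and B1: "B1 \<in> carrier_mat 4 4" and B2: "B2 \<in> carrier_mat 4 4"
    by (simp_all add: B_def B1_def B2_def M)
  note mat4_eq_iff = mat_eq_iff_index[of _ 4 4]
  \<comment> \<open>Row 0 of \<open>B\<close> is nonnegative and column 0 nonpositive, so the two
    products in every correction term cancel and only the signs in row and column 0 change. The same
    holds for index 1 in \<open>B1\<close>.\<close>
  have m1: "mutate 0 B = B1"
    unfolding mat4_eq_iff[OF mutate_carrier[OF B] B1]
    using assms by (simp add: all4 mutate_def B_def B1_def M_def mat_of_rows_list_def)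
  have m2: "mutate 1 B1 = B2"
    unfolding mat4_eq_iff[OF mutate_carrier[OF B1] B2]
    using assms by (simp add: all4 mutate_def B1_def B2_def M_def mat_of_rows_list_def)
  have mut: "mutations 4 1 B = B1" "mutations 4 2 B = B2"
    using m1 m2 by (simp_all add: mutations_def numeral_2_eq_2)
  have "transpose_mat B = - B"
    using B by (subst mat4_eq_iff) (simp_all add: all4 B_def M_def mat_of_rows_list_def)
  \<comment> \<open>The shift by 2 swaps the index pairs 0, 1 and 2, 3. In 2 by 2 blocks,
    \<open>B\<close> and \<open>B2\<close> have the same two equal diagonal blocks, while the
    symmetric block with rows \<open>s, t\<close> and \<open>t, p\<close> is upper right in
    \<open>B\<close> and lower left in \<open>B2\<close>, its negative standing opposite.\<close>
  moreover have "mutation_rotates 4 2 B"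
    using B by (simp add: mutation_rotates_iff all4 mut) (simp add: B_def B2_def M_def mat_of_rows_list_def)
  \<comment> \<open>The entries of \<open>B1\<close> at (1, 2) and (1, 3) are \<open>t\<close> and
    \<open>p\<close>; a rotation would equate them with the entries \<open>r\<close> and
    \<open>s\<close> of \<open>B\<close> at (0, 1) and (0, 2).\<close>
  moreover have "\<not> mutation_rotates 4 1 B"
    using B assms
    by (simp add: mutation_rotates_iff all4 mut del: One_nat_def)
      (auto simp: B_def B1_def M_def mat_of_rows_list_def)
  ultimately have "periodic_quiver 4 2 B"
    using B by (auto simp: periodic_quiver_def quiver_matrix_def less_2_cases_iff)
  then show ?thesis by (simp add: B_def M_def)
qed

end
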